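(* Let $n\in\mathbb{N}$. Then $$t(1,2,2,4;n)=\sigma(8n+9)-S_4(8n+9).$$
   Context: $\mathbb{N}$ denotes the set of positive integers. For $a,b,c,d\in\mathbb{N}$ and an integer $m\ge0$, $t(a,b,c,d;m)$ is the number of $(x,y,z,w)\in\mathbb{Z}^4$ with $m = a\frac{x(x-1)}{2}+b\frac{y(y-1)}{2}+c\frac{z(z-1)}{2}+d\frac{w(w-1)}{2}$. $\sigma(m)$ is the sum of the positive divisors of $m$. For $m,k\in\mathbb{N}$ with $m$ even and $k$ odd, $S_m(k)=\sum r$, the sum over all $(r,s)\in\mathbb{Z}\times\mathbb{Z}$ with $k=r^2+ms^2$ and $r\equiv1\pmod 4$. *)

theory Defs
  imports "HOL-Number_Theory.Number_Theory"
begin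

definition tri_reps :: "nat \<Rightarrow> nat \<Rightarrow> nat \<Rightarrow> nat \<Rightarrow> nat \<Rightarrow> (int \<times> int \<times> int \<times> int) set" where
  "tri_reps a b c d m =
     {(x, y, z, w). int m = int a * (x * (x - 1) div 2) + int b * (y * (y - 1) div 2)
                          + int c * (z * (z - 1) div 2) + int d * (w * (w - 1) div 2)}"

(* The integer divisions in tri_reps are exact, since x * (x - 1) is even. For positive
   a, b, c, d the set is finite (finite_tri_reps below), so card really counts it. *)
definition t :: "nat \<Rightarrow> nat \<Rightarrow> nat \<Rightarrow> nat \<Rightarrow> nat \<Rightarrow> nat" where
  "t a b c d m = card (tri_reps a b c d m)"

definition sigma :: "nat \<Rightarrow> nat" where
  "sigma m = \<Sum>{e. e dvd m}"

definition S_reps :: "nat \<Rightarrow> nat \<Rightarrow> (int \<times> int) set" where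
  "S_reps m k = {(r, s). int k = r\<^sup>2 + int m * s\<^sup>2 \<and> [r = 1] (mod 4)}"

(* Here r may be negative, e.g. r = -3. Every pair (r, s) contributes r, so (r, s) and
   (r, -s) both count. The set is finite for m > 0 (finite_S_reps below). *)
definition S :: "nat \<Rightarrow> nat \<Rightarrow> int" where
  "S m k = (\<Sum>(r, s)\<in>S_reps m k. r)"

lemma tri_nonneg: "0 \<le> x * (x - 1) div (2::int)"
proof (cases "x \<ge> 1")
  case False
  then have "0 \<le> (- x) * (1 - x)" by (intro mult_nonneg_nonneg) auto
  then show ?thesis by (simp add: algebra_simps)
qed simp

lemma tri_bound:
  fixes x :: int
  assumes "x * (x - 1) div 2 \<le> M"
  shows "x \<in> {- M..M + 1}"
proof -
  have ev: "2 * (x * (x - 1) div 2) = x * (x - 1)" by simp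
  show ?thesis
  proof (cases "x \<ge> 2")
    case True
    then have "2 * (x - 1) \<le> x * (x - 1)" by (intro mult_right_mono) auto
    with ev assms True tri_nonneg[of x] show ?thesis by auto
  next
    case False
    show ?thesis
    proof (cases "x \<le> -1")
      case True
      then have "2 * (- x) \<le> (1 - x) * (- x)" by (intro mult_right_mono) auto
      also have "\<dots> = x * (x - 1)" by (simp add: algebra_simps)
      finally show ?thesis using ev assms True tri_nonneg[of x] by auto
    next
      case False
      with \<open>\<not> x \<ge> 2\<close> assms tri_nonneg[of x] show ?thesis by auto
    qed
  qed
qed

lemma finite_tri_reps:
  assumes "a > 0" "b > 0" "c > 0" "d > 0"
  shows "finite (tri_reps a b c d m)"
proof (rule finite_subset)
  let ?I = "{- int m..int m + 1}"
  have le: "u \<le> int e * u" if "e > 0" "0 \<le> u" for e :: nat and u :: int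
    using that mult_right_mono[of 1 "int e" u] by simp
  show "tri_reps a b c d m \<subseteq> ?I \<times> ?I \<times> ?I \<times> ?I"
  proof clarify
    fix x y z w :: int
    assume "(x, y, z, w) \<in> tri_reps a b c d m"
    then have eq: "int m = int a * (x * (x - 1) div 2) + int b * (y * (y - 1) div 2)
        + int c * (z * (z - 1) div 2) + int d * (w * (w - 1) div 2)"
      by (simp add: tri_reps_def)
    note nn = tri_nonneg[of x] tri_nonneg[of y] tri_nonneg[of z] tri_nonneg[of w]
    note l = le[OF assms(1) nn(1)] le[OF assms(2) nn(2)]
      le[OF assms(3) nn(3)] le[OF assms(4) nn(4)]
    have "x * (x - 1) div 2 \<le> int m" "y * (y - 1) div 2 \<le> int m"
      "z * (z - 1) div 2 \<le> int m" "w * (w - 1) div 2 \<le> int m"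
      using eq l nn by linarith+
    then have "x \<in> ?I" "y \<in> ?I" "z \<in> ?I" "w \<in> ?I" by (blast intro: tri_bound)+
    then show "x \<in> ?I \<and> (y, z, w) \<in> ?I \<times> ?I \<times> ?I" by blast
  qed
qed simp

lemma finite_S_reps:
  assumes "m > 0"
  shows "finite (S_reps m k)"
proof (rule finite_subset)
  have sq: "x \<in> {- int k..int k}" if "x\<^sup>2 \<le> int k" for x :: int
  proof -
    have "\<bar>x\<bar> \<le> x\<^sup>2"
    proof (cases "x = 0")
      case False
      then have "1 * \<bar>x\<bar> \<le> \<bar>x\<bar> * \<bar>x\<bar>" by (intro mult_right_mono) auto
      then show ?thesis by (simp only: mult_1 abs_mult_self_eq power2_eq_square)
    qed simp
    with that show ?thesis by auto
  qed
  show "S_reps m k \<subseteq> {- int k..int k} \<times> {- int k..int k}"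
  proof clarify
    fix r s :: int
    assume "(r, s) \<in> S_reps m k"
    then have eq: "int k = r\<^sup>2 + int m * s\<^sup>2" by (simp add: S_reps_def)
    have "s\<^sup>2 \<le> int m * s\<^sup>2" using assms mult_right_mono[of 1 "int m" "s\<^sup>2"] by simp
    then have "r\<^sup>2 \<le> int k" "s\<^sup>2 \<le> int k"
      using eq zero_le_power2[of r] zero_le_power2[of s] by linarith+
    then show "r \<in> {- int k..int k} \<and> s \<in> {- int k..int k}" using sq by blast
  qed
qed simp

end

theory Submission
  imports Defs
begin

text \<open>
Put \<open>N = 8 n + 9\<close> and let \<open>M\<close> be the set of representations
\<open>N = x\<^sup>2 + 4 (a\<^sup>2 + b\<^sup>2 + c\<^sup>2)\<close>. Substituting \<open>y + z - 1\<close>, \<open>y - z\<close> for the two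
middle variables identifies \<open>t(1,2,2,4;n)\<close> with the number of elements of \<open>M\<close> having \<open>a\<close> odd,
so that \<open>|M| - 2 t\<close> is the sum of \<open>(-1)\<^sup>a\<close> over \<open>M\<close>. Since \<open>N\<close> is \<open>1\<close> modulo \<open>4\<close>,
exactly one of the four squares in a sum equal to \<open>N\<close> is odd, whence
\<open>4 |M| = r\<^sub>4(N) = 8 \<sigma>(N)\<close> by Jacobi. The signed sum is \<open>2 S\<^sub>4(N)\<close>, because for \<open>m\<close>
congruent to \<open>1\<close> modulo \<open>4\<close> the sum of \<open>(-1)\<^sup>a\<close> over \<open>m = x\<^sup>2 + 4 (a\<^sup>2 + b\<^sup>2)\<close> is \<open>2 r\<close> if
\<open>m = r\<^sup>2\<close> with \<open>r\<close> congruent to \<open>1\<close> modulo \<open>4\<close>, and \<open>0\<close> if \<open>m\<close> is not a square.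

The two and four square theorems and the last identity are all instances of one identity of
Liouville for sums over \<open>u\<^sup>2 + v w = n\<close>. For the square theorems it shows that the divisor sum
satisfies the recurrence \<open>\<Sum>\<^sub>u (n - (s + 1) u\<^sup>2) r(n - u\<^sup>2) = 0\<close>, which holds for the number
\<open>r\<^sub>s\<close> of representations by \<open>s\<close> squares because the \<open>s + 1\<close> coordinates of a representation
of \<open>n\<close> play symmetric roles.
\<close>

section \<open>Signs modulo 4 and 2, and the solutions of \<open>u^2 + v w = n\<close>\<close>

definition chi :: "int \<Rightarrow> int" where
  "chi x = (if x mod 4 = 1 then 1 else if x mod 4 = 3 then - 1 else 0)"

definition par :: "int \<Rightarrow> int" where
  "par x = (if even x then 1 else - 1)"

definition triples :: "int \<Rightarrow> (int \<times> int \<times> int) set" where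
  "triples n = {(u, v, w). 0 < v \<and> 0 < w \<and> u\<^sup>2 + v * w = n}"

text \<open>On these triples \<open>n = (u + w)^2\<close> with \<open>u + w > 0\<close>, so they
  exist only for square \<open>n\<close>; they carry the correction terms of Liouville's
  identity.\<close>

definition diagonal :: "int \<Rightarrow> (int \<times> int \<times> int) set" where
  "diagonal n = {(u, v, w). (u, v, w) \<in> triples n \<and> v = w + 2 * u}"

lemma chi_minus: "chi (- x) = - chi x"
  unfolding chi_def by presburger

lemma chi_even: "even x \<Longrightarrow> chi x = 0"
  unfolding chi_def by presburger

text \<open>A shift by 2 changes the sign of \<open>chi\<close> at odd arguments; at even arguments
  both sides vanish.\<close>

lemma chi_add_double: "chi (x + 2 * y) = chi x * par y"
  unfolding chi_def par_def by simp presburger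

lemma chi_diff_double: "chi (x - 2 * y) = chi x * par y"
  using chi_add_double[of x "- y"] by (simp add: par_def)

lemma chi_square: "chi x * chi x = (if odd x then 1 else 0)"
  unfolding chi_def by simp presburger

lemma par_minus: "par (- x) = par x"
  by (simp add: par_def)

lemma par_square: "par x * par x = 1"
  by (simp add: par_def)

lemma abs_le_square: "\<bar>x\<bar> \<le> (x::int)\<^sup>2"
proof (cases "x = 0")
  case False
  then have "1 * \<bar>x\<bar> \<le> \<bar>x\<bar> * \<bar>x\<bar>" by (intro mult_right_mono) auto
  then show ?thesis by (simp add: power2_eq_square)
qed simp

lemma square_le_imp_mem: "(x::int)\<^sup>2 \<le> n \<Longrightarrow> x \<in> {- n..n}"
  using abs_le_square[of x] by auto

lemma factors_mem:
  assumes "0 < v" "0 < w" "v * w \<le> (n::int)"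
  shows "v \<in> {1..n}" "w \<in> {1..n}"
proof -
  have "v * 1 \<le> v * w" "1 * w \<le> v * w"
    using assms by (intro mult_left_mono mult_right_mono; simp)+
  with assms show "v \<in> {1..n}" "w \<in> {1..n}"
    unfolding atLeastAtMost_iff by linarith+
qed

lemma triples_subset: "triples n \<subseteq> {- n..n} \<times> {1..n} \<times> {1..n}"
proof clarify
  fix u v w
  assume "(u, v, w) \<in> triples n"
  then have h: "0 < v" "0 < w" "u\<^sup>2 + v * w = n" by (auto simp: triples_def)
  from h have "0 < v * w" by simp
  with h have "u\<^sup>2 \<le> n" "v * w \<le> n" using zero_le_power2[of u] by linarith+
  with h show "u \<in> {- n..n} \<and> (v, w) \<in> {1..n} \<times> {1..n}"
    using square_le_imp_mem factors_mem[of v w n] by blast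
qed

lemma finite_triples: "finite (triples n)"
  by (rule finite_subset[OF triples_subset]) simp

lemma finite_diagonal: "finite (diagonal n)"
  by (rule finite_subset[OF _ finite_triples[of n]]) (auto simp: diagonal_def)

lemma sum_involution_0:
  fixes f :: "'a \<Rightarrow> int"
  assumes "\<And>a. a \<in> A \<Longrightarrow> i a \<in> A" "\<And>a. a \<in> A \<Longrightarrow> i (i a) = a"
    and "\<And>a. a \<in> A \<Longrightarrow> f (i a) = - f a"
  shows "sum f A = 0"
proof -
  have "sum f A = (\<Sum>a\<in>A. f (i a))"
    by (rule sum.reindex_bij_witness[of A i i]) (use assms in auto)
  also have "\<dots> = - sum f A" using assms(3) by (simp add: sum_negf)
  finally show ?thesis by simp
qed

subsection \<open>Liouville's identity\<close>

text \<open>The triples are split by the sign of \<open>w + 2 * u - v\<close>. The summand on the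
  left cancels where this is positive, turns into \<open>F (v + w) u (v - w)\<close> where it is
  negative, and gives the first diagonal sum where it is zero. The sums of
  \<open>F (v + w) u (v - w)\<close> over the two halves agree, whence the factor 2.\<close>

theorem liouville_identity:
  fixes F :: "int \<Rightarrow> int \<Rightarrow> int \<Rightarrow> int"
  assumes odd_F: "\<And>x y z. F (- x) y z = - F x y z"
    and even_F: "\<And>x y z. F x (- y) (- z) = F x y z"
  shows "2 * (\<Sum>(u, v, w)\<in>triples n. F (v - 2 * u) (u + w) (2 * u + 2 * w - v)) =
    (\<Sum>(u, v, w)\<in>triples n. F (v + w) u (v - w)) +
    2 * (\<Sum>(u, v, w)\<in>diagonal n. F w (u + w) w) - (\<Sum>(u, v, w)\<in>diagonal n. F (v + w) u (v - w))"
proof -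
  let ?f = "\<lambda>(u, v, w). F (v - 2 * u) (u + w) (2 * u + 2 * w - v)"
  let ?g = "\<lambda>(u, v, w). F (v + w) u (v - w)"
  let ?P = "\<lambda>R. {(u, v, w). (u, v, w) \<in> triples n \<and> R (w + 2 * u) v}"
  let ?L = "?P (\<lambda>a b. a < b)" and ?G = "?P (\<lambda>a b. a > b)"
  have split: "sum h (triples n) = sum h ?L + sum h (diagonal n) + sum h ?G"
    for h :: "int \<times> int \<times> int \<Rightarrow> int"
  proof -
    have fin: "finite ?L" "finite ?G"
      by (rule finite_subset[OF _ finite_triples[of n]]; auto)+
    have "triples n = (?L \<union> diagonal n) \<union> ?G" by (auto simp: diagonal_def)
    then have "sum h (triples n) = sum h ((?L \<union> diagonal n) \<union> ?G)" by simp
    also have "\<dots> = sum h (?L \<union> diagonal n) + sum h ?G"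
      by (rule sum.union_disjoint) (use fin finite_diagonal in \<open>auto simp: diagonal_def\<close>)
    also have "sum h (?L \<union> diagonal n) = sum h ?L + sum h (diagonal n)"
      by (rule sum.union_disjoint) (use fin finite_diagonal in \<open>auto simp: diagonal_def\<close>)
    finally show ?thesis .
  qed
  \<comment> \<open>For fixed \<open>v\<close> the reflection \<open>u \<mapsto> v - u\<close> negates \<open>v - 2 u\<close> and fixes the other two arguments
    of \<open>F\<close>; it stays inside the triples as long as \<open>w + 2 u > v\<close>.\<close>
  have fG: "sum ?f ?G = 0"
  proof (rule sum_involution_0[where i = "\<lambda>(u, v, w). (v - u, v, w + 2 * u - v)"])
    fix a assume "a \<in> ?G"
    obtain u v w where a: "a = (u, v, w)" by (cases a)
    have "v - 2 * (v - u) = - (v - 2 * u)" "v - u + (w + 2 * u - v) = u + w"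
      "2 * (v - u) + 2 * (w + 2 * u - v) - v = 2 * u + 2 * w - v" by simp_all
    then show "?f ((\<lambda>(u, v, w). (v - u, v, w + 2 * u - v)) a) = - ?f a"
      by (simp only: a prod.case odd_F)
  qed (auto simp: triples_def power2_eq_square algebra_simps)
  \<comment> \<open>A triple of \<open>?L\<close> goes to \<open>(u + w, w, v - 2 * u - w)\<close>,
    whose last entry is positive because \<open>w + 2 * u < v\<close>; the arguments of
    \<open>F\<close> in \<open>?g\<close> there are those in \<open>?f\<close> at
    \<open>(u, v, w)\<close>.\<close>
  have fL: "sum ?f ?L = sum ?g ?G"
    by (rule sum.reindex_bij_witness[of _ "\<lambda>(u, v, w). (u - v, w + 2 * u - v, v)"
          "\<lambda>(u, v, w). (u + w, w, v - 2 * u - w)"])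
      (auto simp: triples_def power2_eq_square algebra_simps)
  have fD: "sum ?f (diagonal n) = (\<Sum>(u, v, w)\<in>diagonal n. F w (u + w) w)"
    by (rule sum.cong) (auto simp: diagonal_def algebra_simps)
  \<comment> \<open>Exchanging \<open>v\<close> and \<open>w\<close> while negating \<open>u\<close>
    swaps the two halves and preserves \<open>?g\<close> by \<open>even_F\<close>.\<close>
  have gL: "sum ?g ?L = sum ?g ?G"
  proof (rule sum.reindex_bij_witness[of _ "\<lambda>(u, v, w). (- u, w, v)" "\<lambda>(u, v, w). (- u, w, v)"])
    fix a assume "a \<in> ?L"
    obtain u v w where a: "a = (u, v, w)" by (cases a)
    show "?g ((\<lambda>(u, v, w). (- u, w, v)) a) = ?g a"
      using even_F[of "v + w" u "v - w"] by (simp add: a add.commute)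
  qed (auto simp: triples_def algebra_simps)
  show ?thesis
    using split[of ?f] split[of ?g] fG fL fD gL by (simp add: algebra_simps)
qed

lemma diagonal_nonsquare:
  assumes "\<And>l. l > 0 \<Longrightarrow> l\<^sup>2 \<noteq> n"
  shows "diagonal n = {}"
proof -
  have False if "(u, v, w) \<in> diagonal n" for u v w
  proof -
    from that have h: "0 < v" "0 < w" "u\<^sup>2 + v * w = n" "v = w + 2 * u"
      by (auto simp: diagonal_def triples_def)
    then have "u + w > 0" "(u + w)\<^sup>2 = n" by (auto simp: power2_eq_square algebra_simps)
    with assms show False by blast
  qed
  then show ?thesis by auto
qed

text \<open>Here \<open>u + w = l\<close>, so \<open>w = j\<close> determines the triple, and
  positivity of \<open>w\<close> and of \<open>v = 2 * l - j\<close> bounds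
  \<open>j\<close>.\<close>

lemma sum_diagonal_square:
  assumes "l > 0"
  shows "sum h (diagonal (l\<^sup>2)) = (\<Sum>j = 1..2 * l - 1. h (l - j, 2 * l - j, j))"
proof (rule sum.reindex_bij_witness[of _ "\<lambda>j. (l - j, 2 * l - j, j)" "\<lambda>(u, v, w). w"])
  fix a assume "a \<in> diagonal (l\<^sup>2)"
  then obtain u v w where a: "a = (u, v, w)"
    and h: "0 < v" "0 < w" "u\<^sup>2 + v * w = l\<^sup>2" "v = w + 2 * u"
    by (auto simp: diagonal_def triples_def)
  from h have "u + w > 0" "(u + w)\<^sup>2 = l\<^sup>2" by (auto simp: power2_eq_square algebra_simps)
  with assms have "u + w = l" by (simp add: power2_eq_iff)
  then have u: "u = l - w" by simp
  show "(\<lambda>j. (l - j, 2 * l - j, j)) ((\<lambda>(u, v, w). w) a) = a" using a h u by simp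
  show "(\<lambda>(u, v, w). w) a \<in> {1..2 * l - 1}" using a h u by simp
  show "h (l - (\<lambda>(u, v, w). w) a, 2 * l - (\<lambda>(u, v, w). w) a, (\<lambda>(u, v, w). w) a) = h a"
    using a h u by simp
qed (auto simp: diagonal_def triples_def power2_eq_square algebra_simps)

section \<open>Divisor sums and the recurrence over squares\<close>

lemma sum_fibres:
  fixes h :: "'a \<Rightarrow> 'b \<Rightarrow> int"
  assumes "finite W" "finite I" "\<And>a y. (a, y) \<in> W \<Longrightarrow> a \<in> I"
  shows "(\<Sum>(a, y)\<in>W. h a y) = (\<Sum>a\<in>I. \<Sum>y | (a, y) \<in> W. h a y)"
proof -
  have "finite {y. (a, y) \<in> W}" for a
    by (rule finite_subset[OF _ finite_imageI[OF assms(1), of snd]]) force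
  moreover have "Sigma I (\<lambda>a. {y. (a, y) \<in> W}) = W" using assms(3) by auto
  ultimately show ?thesis using assms(2) by (simp add: sum.Sigma)
qed

text \<open>Ordered factorisations allow weights in both factors. The value is 0 for
  \<open>k <= 0\<close>, so that \<open>n - u^2\<close> may become negative.\<close>

definition divsum :: "(int \<Rightarrow> int \<Rightarrow> int) \<Rightarrow> int \<Rightarrow> int" where
  "divsum c k = (\<Sum>(v, w) | 0 < v \<and> 0 < w \<and> v * w = k. c v w)"

lemma divsum_nonpos: "k \<le> 0 \<Longrightarrow> divsum c k = 0"
  unfolding divsum_def by (rule sum.neutral) (auto simp: mult_less_0_iff dest: mult_pos_pos)

lemma sum_triples:
  assumes "n \<le> K"
  shows "(\<Sum>(u, v, w)\<in>triples n. g u * c v w) = (\<Sum>u = - K..K. g u * divsum c (n - u\<^sup>2))"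
proof -
  have "(\<Sum>(u, v, w)\<in>triples n. g u * c v w) = (\<Sum>(u, y)\<in>triples n. g u * (case y of (v, w) \<Rightarrow> c v w))"
    by (rule sum.cong) auto
  also have "\<dots> = (\<Sum>u = - K..K. \<Sum>y | (u, y) \<in> triples n. g u * (case y of (v, w) \<Rightarrow> c v w))"
    by (rule sum_fibres) (use finite_triples[of n] triples_subset[of n] assms in force)+
  also have "\<dots> = (\<Sum>u = - K..K. g u * divsum c (n - u\<^sup>2))"
  proof (rule sum.cong)
    fix u
    have "{y. (u, y) \<in> triples n} = {(v, w). 0 < v \<and> 0 < w \<and> v * w = n - u\<^sup>2}"
      by (auto simp: triples_def)
    then show "(\<Sum>y | (u, y) \<in> triples n. g u * (case y of (v, w) \<Rightarrow> c v w)) =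
        g u * divsum c (n - u\<^sup>2)"
      by (simp add: divsum_def sum_distrib_left)
  qed simp
  finally show ?thesis .
qed

text \<open>The term \<open>u = 0\<close> is \<open>n * r n\<close> and every other term has a
  smaller argument, so \<open>r n\<close> is determined by earlier values.\<close>

lemma square_recurrence_unique:
  fixes r r' :: "int \<Rightarrow> int"
  assumes r: "\<And>n. n > 0 \<Longrightarrow> (\<Sum>u = - n..n. (n - k * u\<^sup>2) * r (n - u\<^sup>2)) = 0"
    and r': "\<And>n. n > 0 \<Longrightarrow> (\<Sum>u = - n..n. (n - k * u\<^sup>2) * r' (n - u\<^sup>2)) = 0"
    and init: "\<And>n. n \<le> 0 \<Longrightarrow> r n = r' n"
  shows "r n = r' n"
proof -
  have "\<forall>n. n \<le> int m \<longrightarrow> r n = r' n" for m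
  proof (induction m)
    case 0
    then show ?case using init by simp
  next
    case (Suc m)
    let ?n = "int (Suc m)"
    have split: "(\<Sum>u = - ?n..?n. (?n - k * u\<^sup>2) * f (?n - u\<^sup>2)) = ?n * f ?n +
        (\<Sum>u\<in>{- ?n..?n} - {0}. (?n - k * u\<^sup>2) * f (?n - u\<^sup>2))" for f :: "int \<Rightarrow> int"
      by (subst sum.remove[of _ 0]) simp_all
    have "r (?n - u\<^sup>2) = r' (?n - u\<^sup>2)" if "u \<noteq> 0" for u
    proof -
      from that have "u\<^sup>2 > 0" by simp
      then have "?n - u\<^sup>2 \<le> int m" by linarith
      with Suc show ?thesis by blast
    qed
    then have "(\<Sum>u\<in>{- ?n..?n} - {0}. (?n - k * u\<^sup>2) * r (?n - u\<^sup>2)) =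
        (\<Sum>u\<in>{- ?n..?n} - {0}. (?n - k * u\<^sup>2) * r' (?n - u\<^sup>2))"
      by (intro sum.cong) auto
    then have "?n * r ?n = ?n * r' ?n"
      using r[of ?n] r'[of ?n] split[of r] split[of r'] by linarith
    then have "r ?n = r' ?n" by (simp only: mult_cancel_left) simp
    then show ?case using Suc by (metis int_ops(4) le_imp_less_or_eq zless_imp_add1_zle zle_add1_eq_le add.commute)
  qed
  from this[of "nat n"] show ?thesis by simp
qed

lemma sum_at_square_roots:
  fixes f :: "int \<Rightarrow> int"
  assumes "l > 0"
  shows "(\<Sum>u = - l\<^sup>2..l\<^sup>2. if u\<^sup>2 = l\<^sup>2 then f u else 0) = f l + f (- l)"
proof -
  have "(\<Sum>u = - l\<^sup>2..l\<^sup>2. if u\<^sup>2 = l\<^sup>2 then f u else 0) =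
      (\<Sum>u\<in>{- l, l}. if u\<^sup>2 = l\<^sup>2 then f u else 0)"
    by (rule sum.mono_neutral_right)
      (use abs_le_square[of l] assms in \<open>auto simp: power2_eq_iff\<close>)
  also have "\<dots> = f l + f (- l)" using assms by simp
  finally show ?thesis .
qed

text \<open>The value 1 at argument 0 matters only for \<open>n = l^2\<close>, where
  \<open>u = l\<close> and \<open>u = - l\<close> together add \<open>2 * (1 - k) * n\<close>. By
  the hypothesis \<open>square\<close> the divisor sums cancel exactly this amount.\<close>

lemma recurrence_divsum:
  assumes n: "n > 0"
    and square: "\<And>l. l > 0 \<Longrightarrow> n = l\<^sup>2 \<Longrightarrow>
      C * (\<Sum>(u, v, w)\<in>triples n. (n - k * u\<^sup>2) * c v w) = 2 * (k - 1) * n"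
    and nonsquare: "(\<And>l. l > 0 \<Longrightarrow> l\<^sup>2 \<noteq> n) \<Longrightarrow> (\<Sum>(u, v, w)\<in>triples n. (n - k * u\<^sup>2) * c v w) = 0"
  shows "(\<Sum>u = - n..n. (n - k * u\<^sup>2) *
    (if n - u\<^sup>2 = 0 then 1 else C * divsum c (n - u\<^sup>2))) = 0"
proof -
  have "(\<Sum>u = - n..n. (n - k * u\<^sup>2) * (if n - u\<^sup>2 = 0 then 1 else C * divsum c (n - u\<^sup>2))) =
     (\<Sum>u = - n..n. (n - k * u\<^sup>2) * (C * divsum c (n - u\<^sup>2)) +
        (if u\<^sup>2 = n then n - k * u\<^sup>2 else 0))"
    by (rule sum.cong) (auto simp: divsum_nonpos)
  also have "\<dots> = C * (\<Sum>(u, v, w)\<in>triples n. (n - k * u\<^sup>2) * c v w) +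
      (\<Sum>u = - n..n. if u\<^sup>2 = n then n - k * u\<^sup>2 else 0)"
    unfolding sum_triples[OF order_refl] sum.distrib sum_distrib_left by (simp only: mult.left_commute)
  also have "\<dots> = 0"
  proof (cases "\<exists>l>0. l\<^sup>2 = n")
    case True
    then obtain l where l: "l > 0" "n = l\<^sup>2" by auto
    then show ?thesis
      using square[OF l] sum_at_square_roots[OF l(1), of "\<lambda>u. n - k * u\<^sup>2", folded l(2)]
      by (simp only: power2_minus) (simp add: l(2) left_diff_distrib)
  next
    case False
    then have "u\<^sup>2 \<noteq> n" for u
      using n by (metis abs_of_nonneg power2_abs zero_less_abs_iff zero_power2 less_irrefl)
    then show ?thesis using nonsquare False by auto
  qed
  finally show ?thesis .
qed

subsection \<open>Three instances of the identity\<close>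

text \<open>Diagonal sums run over \<open>1..2 * l - 1\<close>. Raising \<open>l\<close> by one adds
  an even and an odd index, which gives the closed forms below by induction.\<close>

lemma odd_interval_Suc:
  fixes i :: int
  assumes "0 < i"
  shows "sum f {1..2 * (i + 1) - 1} = sum f {1..2 * i - 1} + f (2 * i) + f (2 * i + 1)"
proof -
  have "{1..2 * (i + 1) - 1} = insert (2 * i + 1) (insert (2 * i) {1..2 * i - 1})"
    using assms by auto
  then show ?thesis by (simp add: ac_simps)
qed

lemma sum_mult_chi: "0 < l \<Longrightarrow> (\<Sum>j = 1..2 * l - 1. j * chi j) = - par l * l"
proof (induction l rule: int_gr_induct)
  case base
  show ?case by (simp add: chi_def par_def)
next
  case (step i)
  have "chi (2 * i + 1) = par i" using chi_add_double[of 1 i] by (simp add: chi_def add.commute)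
  then show ?case
    using step by (subst odd_interval_Suc) (auto simp: chi_even par_def)
qed

lemma sum_chi_square: "0 < l \<Longrightarrow> (\<Sum>j = 1..2 * l - 1. chi j * chi j) = l"
proof (induction l rule: int_gr_induct)
  case (step i)
  then show ?case by (subst odd_interval_Suc) (auto simp: chi_square)
qed (simp add: chi_def)

lemma sum_par: "0 < l \<Longrightarrow> (\<Sum>j = 1..2 * l - 1. par j) = - 1"
proof (induction l rule: int_gr_induct)
  case (step i)
  then show ?case by (subst odd_interval_Suc) (auto simp: par_def)
qed (simp add: par_def)

lemma sum_par_mult: "0 < l \<Longrightarrow> (\<Sum>j = 1..2 * l - 1. par j * j) = - l"
proof (induction l rule: int_gr_induct)
  case (step i)
  then show ?case by (subst odd_interval_Suc) (auto simp: par_def)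
qed (simp add: par_def)

lemma sum_par_mult_square: "0 < l \<Longrightarrow> (\<Sum>j = 1..2 * l - 1. par j * j\<^sup>2) = l - 2 * l\<^sup>2"
proof (induction l rule: int_gr_induct)
  case (step i)
  then show ?case
    by (subst odd_interval_Suc) (auto simp: par_def power2_eq_square algebra_simps)
qed (simp add: par_def)

lemma sum_triples_odd_0:
  assumes "\<And>u v w. (u, v, w) \<in> triples n \<Longrightarrow> f (- u) v w = - f u v w"
  shows "(\<Sum>(u, v, w)\<in>triples n. f u v w) = (0 :: int)"
  by (rule sum_involution_0[where i = "\<lambda>(u, v, w). (- u, v, w)"])
    (use assms in \<open>auto simp: triples_def\<close>)

text \<open>Liouville's identity for \<open>par y * x * y * chi z\<close>. The sign produced by
  \<open>chi (2 * (u + w) - v)\<close> absorbs \<open>par (u + w)\<close>, and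
  \<open>(v - 2 * u) * (u + w)\<close> is \<open>n - 3 * u^2\<close> plus terms odd in
  \<open>u\<close>, which cancel. The sums of \<open>F (v + w) u (v - w)\<close> vanish by oddness
  in \<open>u\<close> and, on the diagonal, because \<open>v - w\<close> is even.\<close>

lemma chi_recurrence:
  "(\<Sum>(u, v, w)\<in>triples n. (n - 3 * u\<^sup>2) * chi v) = - (\<Sum>(u, v, w)\<in>diagonal n. par (u + w) * w * (u + w) * chi w)"
proof -
  define F where "F x y z = par y * x * y * chi z" for x y z
  have "(\<Sum>(u, v, w)\<in>triples n. F (v - 2 * u) (u + w) (2 * u + 2 * w - v)) =
      (\<Sum>(u, v, w)\<in>triples n. - ((n - 3 * u\<^sup>2) * chi v) + u * (2 * w - v) * chi v)"
  proof (rule sum.cong)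
    fix a assume "a \<in> triples n"
    then obtain u v w where a: "a = (u, v, w)" and n: "n = u\<^sup>2 + v * w" by (auto simp: triples_def)
    have c: "chi (2 * u + 2 * w - v) = - chi v * par (u + w)"
      using chi_add_double[of "- v" "u + w"] by (simp add: chi_minus algebra_simps)
    have "F (v - 2 * u) (u + w) (2 * u + 2 * w - v) =
        (par (u + w) * par (u + w)) * - ((v - 2 * u) * (u + w) * chi v)"
      unfolding F_def c by (simp only: ac_simps) simp
    also have "\<dots> = - ((n - 3 * u\<^sup>2) * chi v) + u * (2 * w - v) * chi v"
      unfolding par_square n by (simp add: power2_eq_square algebra_simps)
    finally show "(case a of (u, v, w) \<Rightarrow> F (v - 2 * u) (u + w) (2 * u + 2 * w - v)) =
      (case a of (u, v, w) \<Rightarrow> - ((n - 3 * u\<^sup>2) * chi v) + u * (2 * w - v) * chi v)"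
      by (simp add: a)
  qed simp
  also have "\<dots> = - (\<Sum>(u, v, w)\<in>triples n. (n - 3 * u\<^sup>2) * chi v) +
      (\<Sum>(u, v, w)\<in>triples n. u * (2 * w - v) * chi v)"
    by (simp only: sum.distrib sum_negf case_prod_unfold)
  also have "(\<Sum>(u, v, w)\<in>triples n. u * (2 * w - v) * chi v) = 0"
    by (rule sum_triples_odd_0) simp
  finally have L: "(\<Sum>(u, v, w)\<in>triples n. F (v - 2 * u) (u + w) (2 * u + 2 * w - v)) =
      - (\<Sum>(u, v, w)\<in>triples n. (n - 3 * u\<^sup>2) * chi v)" by simp
  have R: "(\<Sum>(u, v, w)\<in>triples n. F (v + w) u (v - w)) = 0"
    by (rule sum_triples_odd_0) (simp add: F_def par_minus)
  have B: "(\<Sum>(u, v, w)\<in>diagonal n. F (v + w) u (v - w)) = 0"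
    by (rule sum.neutral) (auto simp: diagonal_def F_def chi_even)
  have "2 * (\<Sum>(u, v, w)\<in>triples n. F (v - 2 * u) (u + w) (2 * u + 2 * w - v)) =
    (\<Sum>(u, v, w)\<in>triples n. F (v + w) u (v - w)) +
    2 * (\<Sum>(u, v, w)\<in>diagonal n. F w (u + w) w) - (\<Sum>(u, v, w)\<in>diagonal n. F (v + w) u (v - w))"
    by (rule liouville_identity) (simp_all add: F_def par_minus chi_minus)
  with L R B have "(\<Sum>(u, v, w)\<in>triples n. (n - 3 * u\<^sup>2) * chi v) =
     - (\<Sum>(u, v, w)\<in>diagonal n. F w (u + w) w)" by linarith
  then show ?thesis by (simp add: F_def)
qed

text \<open>The sign that makes the divisor sum of \<open>(2 w - v) corr v w\<close> over \<open>v w = n\<close> equal to the sum of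
the divisors of \<open>n\<close> that are not divisible by \<open>4\<close>.\<close>

definition corr :: "int \<Rightarrow> int \<Rightarrow> int" where
  "corr v w = (if even v \<and> even w then - 1 else 1)"

text \<open>Liouville's identity for \<open>x * y * z * corr x (y + n)\<close>. The shift by
  \<open>n = u^2 + v * w\<close> makes the sign equal to \<open>corr v w\<close>: for even
  \<open>v\<close> the parity of \<open>u + w + n\<close> is that of \<open>w\<close>. The product
  of the three arguments is \<open>(n - 5 * u^2) * (2 * w - v)\<close> up to terms odd in
  \<open>u\<close>.\<close>

lemma corr_recurrence:
  "2 * (\<Sum>(u, v, w)\<in>triples n. (n - 5 * u\<^sup>2) * ((2 * w - v) * corr v w)) =
    2 * (\<Sum>(u, v, w)\<in>diagonal n. w\<^sup>2 * (u + w) * corr w (u + w + n)) -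
    (\<Sum>(u, v, w)\<in>diagonal n. 2 * u\<^sup>2 * (v + w) * corr 2 (u + n))"
proof -
  define F where "F x y z = x * y * z * corr x (y + n)" for x y z
  have "(\<Sum>(u, v, w)\<in>triples n. F (v - 2 * u) (u + w) (2 * u + 2 * w - v)) =
      (\<Sum>(u, v, w)\<in>triples n. (n - 5 * u\<^sup>2) * ((2 * w - v) * corr v w) +
         (2 * u * (v * w - 2 * u\<^sup>2) - u * (v - 2 * w)\<^sup>2) * corr v w)"
  proof (rule sum.cong)
    fix a assume "a \<in> triples n"
    then obtain u v w where a: "a = (u, v, w)" and n: "n = u\<^sup>2 + v * w" by (auto simp: triples_def)
    have c: "corr (v - 2 * u) (u + w + n) = corr v w"
      unfolding corr_def n by auto
    have "F (v - 2 * u) (u + w) (2 * u + 2 * w - v) =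
        ((v - 2 * u) * (u + w) * (2 * u + 2 * w - v)) * corr v w"
      unfolding F_def c by simp
    also have "(v - 2 * u) * (u + w) * (2 * u + 2 * w - v) =
        (n - 5 * u\<^sup>2) * (2 * w - v) + (2 * u * (v * w - 2 * u\<^sup>2) - u * (v - 2 * w)\<^sup>2)"
      unfolding n by (simp add: power2_eq_square algebra_simps)
    finally show "(case a of (u, v, w) \<Rightarrow> F (v - 2 * u) (u + w) (2 * u + 2 * w - v)) =
      (case a of (u, v, w) \<Rightarrow> (n - 5 * u\<^sup>2) * ((2 * w - v) * corr v w) +
         (2 * u * (v * w - 2 * u\<^sup>2) - u * (v - 2 * w)\<^sup>2) * corr v w)"
      by (simp add: a distrib_right)
  qed simp
  also have "\<dots> = (\<Sum>(u, v, w)\<in>triples n. (n - 5 * u\<^sup>2) * ((2 * w - v) * corr v w)) +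
      (\<Sum>(u, v, w)\<in>triples n. (2 * u * (v * w - 2 * u\<^sup>2) - u * (v - 2 * w)\<^sup>2) * corr v w)"
    by (simp add: sum.distrib case_prod_unfold)
  also have "(\<Sum>(u, v, w)\<in>triples n. (2 * u * (v * w - 2 * u\<^sup>2) - u * (v - 2 * w)\<^sup>2) * corr v w) = 0"
    by (rule sum_triples_odd_0) (simp add: algebra_simps)
  finally have L: "(\<Sum>(u, v, w)\<in>triples n. F (v - 2 * u) (u + w) (2 * u + 2 * w - v)) =
      (\<Sum>(u, v, w)\<in>triples n. (n - 5 * u\<^sup>2) * ((2 * w - v) * corr v w))" by simp
  have R: "(\<Sum>(u, v, w)\<in>triples n. F (v + w) u (v - w)) = 0"
    by (rule sum_triples_odd_0) (simp add: F_def corr_def)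
  \<comment> \<open>On the diagonal \<open>v - w = 2 * u\<close> and \<open>v + w\<close> is even,
    so 2 can stand as the first argument of \<open>corr\<close>.\<close>
  have B: "(\<Sum>(u, v, w)\<in>diagonal n. F (v + w) u (v - w)) =
      (\<Sum>(u, v, w)\<in>diagonal n. 2 * u\<^sup>2 * (v + w) * corr 2 (u + n))"
    by (rule sum.cong) (auto simp: diagonal_def F_def corr_def power2_eq_square)
  have "2 * (\<Sum>(u, v, w)\<in>triples n. F (v - 2 * u) (u + w) (2 * u + 2 * w - v)) =
    (\<Sum>(u, v, w)\<in>triples n. F (v + w) u (v - w)) +
    2 * (\<Sum>(u, v, w)\<in>diagonal n. F w (u + w) w) - (\<Sum>(u, v, w)\<in>diagonal n. F (v + w) u (v - w))"
    by (rule liouville_identity) (simp_all add: F_def corr_def)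
  with L R B show ?thesis by (simp add: F_def power2_eq_square ac_simps)
qed

text \<open>Liouville's identity for \<open>chi x * chi y * chi z\<close>. For odd \<open>u\<close>
  the terms of \<open>u\<close> and \<open>- u\<close> cancel: either \<open>v\<close> is even and
  \<open>chi (v - 2 * u)\<close> vanishes, or 4 divides \<open>w\<close> because \<open>u^2\<close>
  and \<open>n\<close> are both 1 modulo 4. For even \<open>u\<close> both \<open>v\<close> and
  \<open>w\<close> are odd and the product reduces to \<open>chi w * par (u div 2)\<close>.\<close>

lemma three_squares_identity:
  assumes "n mod 4 = 1"
  shows "(\<Sum>(u, v, w)\<in>triples n. if even u then chi v * par (u div 2) else 0) =
    (\<Sum>(u, v, w)\<in>diagonal n. chi (u + w) * (chi w * chi w))"
proof -
  define F where "F x y z = chi x * chi y * chi z" for x y z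
  let ?e = "\<lambda>u v w. if even u then chi w * par (u div 2) else 0"
  let ?o = "\<lambda>u v w. if odd u then F (v - 2 * u) (u + w) (2 * u + 2 * w - v) else 0"
  have "(\<Sum>(u, v, w)\<in>triples n. F (v - 2 * u) (u + w) (2 * u + 2 * w - v)) =
      (\<Sum>(u, v, w)\<in>triples n. ?e u v w + ?o u v w)"
  proof (rule sum.cong)
    fix a assume "a \<in> triples n"
    then obtain u v w where a: "a = (u, v, w)" and n: "n = u\<^sup>2 + v * w" by (auto simp: triples_def)
    have "F (v - 2 * u) (u + w) (2 * u + 2 * w - v) = chi w * par (u div 2)" if u: "even u"
    proof -
      have "odd n" using assms by presburger
      with n u have vw: "odd v" "odd w" by auto
      have "chi (v - 2 * u) = chi v" using u by (simp add: chi_diff_double par_def)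
      moreover have "chi (2 * u + 2 * w - v) = chi v"
        using chi_add_double[of "- v" "u + w"] u vw
        by (simp add: chi_minus par_def algebra_simps)
      moreover have "chi (u + w) = chi w * par (u div 2)"
        using chi_add_double[of w "u div 2"] u by (simp add: add.commute)
      ultimately have "F (v - 2 * u) (u + w) (2 * u + 2 * w - v) =
          (chi v * chi v) * (chi w * par (u div 2))"
        unfolding F_def by (simp only: ac_simps)
      with vw show ?thesis by (simp add: chi_square)
    qed
    then show "(case a of (u, v, w) \<Rightarrow> F (v - 2 * u) (u + w) (2 * u + 2 * w - v)) =
        (case a of (u, v, w) \<Rightarrow> ?e u v w + ?o u v w)" by (simp add: a)
  qed simp
  also have "\<dots> = (\<Sum>(u, v, w)\<in>triples n. ?e u v w) + (\<Sum>(u, v, w)\<in>triples n. ?o u v w)"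
    by (simp only: sum.distrib case_prod_unfold)
  also have "(\<Sum>(u, v, w)\<in>triples n. ?o u v w) = 0"
  proof (rule sum_triples_odd_0)
    fix u v w assume "(u, v, w) \<in> triples n"
    then have n: "n = u\<^sup>2 + v * w" by (auto simp: triples_def)
    show "?o (- u) v w = - ?o u v w"
    proof (cases "odd u \<and> odd v")
      case True
      have "u mod 4 = 1 \<or> u mod 4 = 3" using True by presburger
      then have "u\<^sup>2 mod 4 = 1" by (auto simp: power2_eq_square mod_mult_eq[of u 4 u, symmetric])
      with n assms have "(v * w) mod 4 = 0" by presburger
      then have "4 dvd v * w" by presburger
      moreover have "coprime 4 v" using True
        by (metis coprime_commute coprime_power_right_iff coprime_right_2_iff_odd numeral_Bit0 power2_eq_square mult_2 num_double numeral_times_numeral pos2)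
      ultimately have "4 dvd w" by (simp add: coprime_dvd_mult_right_iff)
      then obtain k where k: "w = 4 * k" by auto
      have "chi (u + w) = chi u" "chi (- u + w) = - chi u"
        using chi_add_double[of u "2 * k"] chi_add_double[of "- u" "2 * k"]
        by (simp_all add: k par_def chi_minus)
      moreover have "chi (2 * u + 2 * w - v) = chi v" "chi (2 * (- u) + 2 * w - v) = chi v"
        using chi_add_double[of "- v" "u + w"] chi_add_double[of "- v" "- u + w"] True
        by (simp_all add: k par_def chi_minus algebra_simps)
      moreover have "chi (v - 2 * u) = chi (v - 2 * (- u))"
        by (simp only: chi_diff_double par_minus)
      ultimately show ?thesis unfolding F_def by simp
    next
      case False
      then show ?thesis by (auto simp: F_def chi_even)
    qed
  qed
  finally have L: "(\<Sum>(u, v, w)\<in>triples n. F (v - 2 * u) (u + w) (2 * u + 2 * w - v)) =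
      (\<Sum>(u, v, w)\<in>triples n. ?e u v w)" by simp
  have swap: "(\<Sum>(u, v, w)\<in>triples n. ?e u v w) = (\<Sum>(u, v, w)\<in>triples n. ?e u w v)"
    by (rule sum.reindex_bij_witness[of _ "\<lambda>(u, v, w). (u, w, v)" "\<lambda>(u, v, w). (u, w, v)"])
      (auto simp: triples_def mult.commute)
  have R: "(\<Sum>(u, v, w)\<in>triples n. F (v + w) u (v - w)) = 0"
    by (rule sum_triples_odd_0) (simp add: F_def chi_minus)
  have B: "(\<Sum>(u, v, w)\<in>diagonal n. F (v + w) u (v - w)) = 0"
    by (rule sum.neutral) (auto simp: diagonal_def F_def chi_even)
  have "2 * (\<Sum>(u, v, w)\<in>triples n. F (v - 2 * u) (u + w) (2 * u + 2 * w - v)) =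
    (\<Sum>(u, v, w)\<in>triples n. F (v + w) u (v - w)) +
    2 * (\<Sum>(u, v, w)\<in>diagonal n. F w (u + w) w) - (\<Sum>(u, v, w)\<in>diagonal n. F (v + w) u (v - w))"
    by (rule liouville_identity) (simp_all add: F_def chi_minus)
  with L R B swap have "(\<Sum>(u, v, w)\<in>triples n. ?e u w v) = (\<Sum>(u, v, w)\<in>diagonal n. F w (u + w) w)"
    by linarith
  then show ?thesis by (simp add: F_def ac_simps)
qed

subsection \<open>Sums of two and of four squares\<close>

text \<open>With lists, rotation permutes the coordinates, and removing the head passes from
  \<open>Suc s\<close> to \<open>s\<close> squares.\<close>

definition sq_reps :: "nat \<Rightarrow> int \<Rightarrow> int list set" where
  "sq_reps s n = {xs. length xs = s \<and> (\<Sum>x\<leftarrow>xs. x\<^sup>2) = n}"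

lemma finite_sq_reps: "finite (sq_reps s n)"
proof (rule finite_subset)
  show "sq_reps s n \<subseteq> {xs. set xs \<subseteq> {- n..n} \<and> length xs = s}"
  proof clarify
    fix xs assume xs: "xs \<in> sq_reps s n"
    have "x\<^sup>2 \<le> n" if "x \<in> set xs" for x
    proof -
      have "x\<^sup>2 \<le> (\<Sum>x\<leftarrow>xs. x\<^sup>2)" by (rule member_le_sum_list) (use that in auto)
      with xs show ?thesis by (simp add: sq_reps_def)
    qed
    then show "set xs \<subseteq> {- n..n} \<and> length xs = s"
      using square_le_imp_mem xs by (auto simp: sq_reps_def)
  qed
qed (simp add: finite_lists_length_eq)

lemma rotate1_sq_reps: "xs \<in> sq_reps s n \<Longrightarrow> rotate1 xs \<in> sq_reps s n"
  by (cases xs) (auto simp: sq_reps_def)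

lemma sum_sq_reps_rotate1: "(\<Sum>xs\<in>sq_reps s n. f (rotate1 xs)) = (\<Sum>xs\<in>sq_reps s n. f xs)"
proof (rule sum.reindex_bij_betw)
  have "inj_on rotate1 (sq_reps s n)"
    using inj_rotate1 by (auto intro: inj_on_subset)
  moreover have "rotate1 ` sq_reps s n \<subseteq> sq_reps s n" using rotate1_sq_reps by auto
  ultimately show "bij_betw rotate1 (sq_reps s n) (sq_reps s n)"
    using endo_inj_surj[OF finite_sq_reps] by (simp add: bij_betw_def)
qed

text \<open>Rotation permutes the representations and moves entry \<open>i + 1\<close> to position
  \<open>i\<close>.\<close>

lemma sum_sq_reps_coordinate:
  fixes f :: "int \<Rightarrow> int"
  assumes "i < s"
  shows "(\<Sum>xs\<in>sq_reps s n. f (xs ! i)) = (\<Sum>xs\<in>sq_reps s n. f (xs ! 0))"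
  using assms
proof (induction i)
  case (Suc i)
  have "(\<Sum>xs\<in>sq_reps s n. f (xs ! Suc i)) = (\<Sum>xs\<in>sq_reps s n. f (rotate1 xs ! i))"
    by (rule sum.cong) (use Suc.prems in \<open>auto simp: sq_reps_def nth_rotate1\<close>)
  also have "\<dots> = (\<Sum>xs\<in>sq_reps s n. f (xs ! i))" by (rule sum_sq_reps_rotate1)
  finally show ?case using Suc by simp
qed simp

lemma sum_sq_reps_coordinates:
  fixes f :: "int \<Rightarrow> int"
  shows "(\<Sum>xs\<in>sq_reps s n. \<Sum>i<s. f (xs ! i)) = int s * (\<Sum>xs\<in>sq_reps s n. f (xs ! 0))"
proof -
  have "(\<Sum>xs\<in>sq_reps s n. \<Sum>i<s. f (xs ! i)) = (\<Sum>i<s. \<Sum>xs\<in>sq_reps s n. f (xs ! i))"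
    by (rule sum.swap)
  also have "\<dots> = (\<Sum>i<s. \<Sum>xs\<in>sq_reps s n. f (xs ! 0))"
    by (intro sum.cong sum_sq_reps_coordinate) auto
  finally show ?thesis by simp
qed

lemma sum_sq_reps_Suc:
  "(\<Sum>xs\<in>sq_reps (Suc s) n. g (xs ! 0)) = (\<Sum>u = - n..n. g u * int (card (sq_reps s (n - u\<^sup>2))))"
proof -
  let ?W = "{(u, xs). xs \<in> sq_reps s (n - u\<^sup>2)}"
  have "(\<Sum>xs\<in>sq_reps (Suc s) n. g (xs ! 0)) = (\<Sum>(u, xs)\<in>?W. g u)"
    by (rule sum.reindex_bij_witness[of _ "\<lambda>(u, xs). u # xs" "\<lambda>xs. (hd xs, tl xs)"])
      (auto simp: sq_reps_def length_Suc_conv)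
  also have "\<dots> = (\<Sum>u = - n..n. \<Sum>xs | (u, xs) \<in> ?W. g u)"
  proof (rule sum_fibres)
    have "?W = (\<lambda>xs. (hd xs, tl xs)) ` sq_reps (Suc s) n"
      by (force simp: sq_reps_def image_iff length_Suc_conv)
    then show "finite ?W" using finite_sq_reps by simp
    fix u xs assume "(u, xs) \<in> ?W"
    then have "(\<Sum>x\<leftarrow>xs. x\<^sup>2) = n - u\<^sup>2" by (simp add: sq_reps_def)
    moreover have "0 \<le> (\<Sum>x\<leftarrow>xs. x\<^sup>2)" by (rule sum_list_nonneg) auto
    ultimately have "u\<^sup>2 \<le> n" by simp
    then show "u \<in> {- n..n}" by (rule square_le_imp_mem)
  qed simp
  finally show ?thesis by (simp add: mult.commute)
qed

text \<open>Over the representations of \<open>n\<close> by \<open>Suc s\<close> squares all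
  coordinates have the same total of squares, so \<open>n - (s + 1) u^2\<close> sums to 0 for the
  first entry \<open>u\<close>. The other entries represent \<open>n - u^2\<close>.\<close>

lemma sq_reps_recurrence:
  "(\<Sum>u = - n..n. (n - int (Suc s) * u\<^sup>2) * int (card (sq_reps s (n - u\<^sup>2)))) = 0"
proof -
  have "(\<Sum>xs\<in>sq_reps (Suc s) n. \<Sum>i<Suc s. (xs ! i)\<^sup>2) = (\<Sum>xs\<in>sq_reps (Suc s) n. n)"
    by (rule sum.cong) (auto simp: sq_reps_def sum_list_sum_nth atLeast0LessThan simp del: sum.lessThan_Suc)
  then have "int (Suc s) * (\<Sum>xs\<in>sq_reps (Suc s) n. (xs ! 0)\<^sup>2) = (\<Sum>xs\<in>sq_reps (Suc s) n. n)"
    using sum_sq_reps_coordinates[of "\<lambda>x. x\<^sup>2" "Suc s" n] by simp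
  then have "(\<Sum>xs\<in>sq_reps (Suc s) n. n - int (Suc s) * (xs ! 0)\<^sup>2) = 0"
    by (simp only: sum_subtractf flip: sum_distrib_left)
  then show ?thesis using sum_sq_reps_Suc[of "\<lambda>u. n - int (Suc s) * u\<^sup>2" s n] by simp
qed

lemma card_sq_reps_nonpos:
  assumes "n \<le> 0"
  shows "int (card (sq_reps s n)) = (if n = 0 then 1 else 0)"
proof -
  have nonneg: "0 \<le> (\<Sum>x\<leftarrow>xs. x\<^sup>2)" for xs :: "int list" by (rule sum_list_nonneg) auto
  have "xs = replicate (length xs) 0" if "(\<Sum>x\<leftarrow>xs. x\<^sup>2) = 0" for xs :: "int list"
    using that
  proof (induction xs)
    case (Cons x xs)
    have "0 \<le> x\<^sup>2" by simp
    moreover have "x\<^sup>2 + (\<Sum>x\<leftarrow>xs. x\<^sup>2) = 0" using Cons.prems by simp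
    ultimately have "x\<^sup>2 = 0" "(\<Sum>x\<leftarrow>xs. x\<^sup>2) = 0" using nonneg[of xs] by linarith+
    with Cons.IH show ?case by simp
  qed simp
  then have "sq_reps s 0 \<subseteq> {replicate s 0}" by (auto simp: sq_reps_def)
  moreover have "replicate s 0 \<in> sq_reps s 0" by (simp add: sq_reps_def sum_list_replicate)
  ultimately have "sq_reps s 0 = {replicate s 0}" by blast
  moreover have "sq_reps s n = {}" if "n < 0"
    using nonneg that by (auto simp: sq_reps_def simp flip: not_le)
  ultimately show ?thesis using assms by (cases "n = 0") auto
qed

lemma card_sq_reps_eq_divsum:
  assumes square: "\<And>l. l > 0 \<Longrightarrow>
      C * (\<Sum>(u, v, w)\<in>triples (l\<^sup>2). (l\<^sup>2 - int (Suc s) * u\<^sup>2) * c v w) = 2 * (int (Suc s) - 1) * l\<^sup>2"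
    and nonsquare: "\<And>n. n > 0 \<Longrightarrow> (\<And>l. l > 0 \<Longrightarrow> l\<^sup>2 \<noteq> n) \<Longrightarrow>
      (\<Sum>(u, v, w)\<in>triples n. (n - int (Suc s) * u\<^sup>2) * c v w) = 0"
  shows "int (card (sq_reps s n)) = (if n = 0 then 1 else C * divsum c n)"
proof (rule square_recurrence_unique[where k = "int (Suc s)" and r = "\<lambda>n. int (card (sq_reps s n))"
      and r' = "\<lambda>n. if n = 0 then 1 else C * divsum c n"])
  fix n :: int assume "n > 0"
  then show "(\<Sum>u = - n..n. (n - int (Suc s) * u\<^sup>2) *
      (if n - u\<^sup>2 = 0 then 1 else C * divsum c (n - u\<^sup>2))) = 0"
    by (rule recurrence_divsum) (use square nonsquare \<open>n > 0\<close> in blast)+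
qed (rule sq_reps_recurrence, simp add: card_sq_reps_nonpos divsum_nonpos)

text \<open>Jacobi's two square theorem. For \<open>n = l^2\<close> the diagonal has
  \<open>u + w = l\<close>, and \<open>sum_mult_chi\<close> evaluates the sum to \<open>l^2\<close>;
  the constant 4 fits since \<open>4 = 2 * (3 - 1)\<close>.\<close>

theorem two_squares: "int (card (sq_reps 2 n)) = (if n = 0 then 1 else 4 * divsum (\<lambda>v w. chi v) n)"
proof (rule card_sq_reps_eq_divsum)
  fix l :: int assume l: "l > 0"
  have "(\<Sum>(u, v, w)\<in>triples (l\<^sup>2). (l\<^sup>2 - 3 * u\<^sup>2) * chi v) = - (par l * l * (\<Sum>j = 1..2 * l - 1. j * chi j))"
    using l by (subst chi_recurrence) (simp_all add: sum_diagonal_square sum_distrib_left ac_simps)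
  also have "\<dots> = l\<^sup>2"
    using par_square[of l] l by (simp add: sum_mult_chi power2_eq_square) 
  finally show "4 * (\<Sum>(u, v, w)\<in>triples (l\<^sup>2). (l\<^sup>2 - int (Suc 2) * u\<^sup>2) * chi v) = 2 * (int (Suc 2) - 1) * l\<^sup>2"
    by simp
next
  fix n :: int assume "n > 0" "\<And>l. l > 0 \<Longrightarrow> l\<^sup>2 \<noteq> n"
  then show "(\<Sum>(u, v, w)\<in>triples n. (n - int (Suc 2) * u\<^sup>2) * chi v) = 0"
    by (simp add: chi_recurrence diagonal_nonsquare)
qed

text \<open>Jacobi's four square theorem. The sum for \<open>n = l^2\<close> is again
  \<open>l^2\<close>, and \<open>8 = 2 * (5 - 1)\<close>.\<close>

theorem four_squares:
  "int (card (sq_reps 4 n)) = (if n = 0 then 1 else 8 * divsum (\<lambda>v w. (2 * w - v) * corr v w) n)"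
proof (rule card_sq_reps_eq_divsum)
  fix l :: int assume l: "l > 0"
  have "2 * (\<Sum>(u, v, w)\<in>triples (l\<^sup>2). (l\<^sup>2 - 5 * u\<^sup>2) * ((2 * w - v) * corr v w)) =
      2 * (\<Sum>j = 1..2 * l - 1. j\<^sup>2 * l * corr j (l + l\<^sup>2)) -
      (\<Sum>j = 1..2 * l - 1. 2 * (l - j)\<^sup>2 * (2 * l) * corr 2 (l - j + l\<^sup>2))"
    using l by (simp add: corr_recurrence sum_diagonal_square)
  \<comment> \<open>As \<open>l + l^2\<close> is even, \<open>corr j (l + l^2)\<close> is
    \<open>- par j\<close>. In the second sum \<open>l - j + l^2\<close> has the parity of
    \<open>j\<close>, so \<open>corr\<close> is again \<open>- par j\<close>.\<close>
  also have "(\<Sum>j = 1..2 * l - 1. j\<^sup>2 * l * corr j (l + l\<^sup>2)) = - l * (\<Sum>j = 1..2 * l - 1. par j * j\<^sup>2)"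
    unfolding sum_distrib_left by (rule sum.cong) (auto simp: corr_def par_def)
  also have "(\<Sum>j = 1..2 * l - 1. 2 * (l - j)\<^sup>2 * (2 * l) * corr 2 (l - j + l\<^sup>2)) =
      (\<Sum>j = 1..2 * l - 1. - 4 * l * (l\<^sup>2 * par j - 2 * l * (par j * j) + par j * j\<^sup>2))"
    by (rule sum.cong) (auto simp: corr_def par_def power2_eq_square algebra_simps)
  also have "\<dots> = - 4 * l * (l\<^sup>2 * (\<Sum>j = 1..2 * l - 1. par j) - 2 * l * (\<Sum>j = 1..2 * l - 1. par j * j)
      + (\<Sum>j = 1..2 * l - 1. par j * j\<^sup>2))"
    by (simp only: sum.distrib sum_subtractf flip: sum_distrib_left)
  also have "2 * (- l * (\<Sum>j = 1..2 * l - 1. par j * j\<^sup>2)) - \<dots> = 2 * l\<^sup>2"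
    unfolding sum_par[OF l] sum_par_mult[OF l] sum_par_mult_square[OF l]
    by (simp add: power2_eq_square algebra_simps)
  finally have "2 * (\<Sum>(u, v, w)\<in>triples (l\<^sup>2). (l\<^sup>2 - 5 * u\<^sup>2) * ((2 * w - v) * corr v w)) = 2 * l\<^sup>2" .
  then show "8 * (\<Sum>(u, v, w)\<in>triples (l\<^sup>2). (l\<^sup>2 - int (Suc 4) * u\<^sup>2) * ((2 * w - v) * corr v w)) =
      2 * (int (Suc 4) - 1) * l\<^sup>2"
    by simp
next
  fix n :: int assume "n > 0" "\<And>l. l > 0 \<Longrightarrow> l\<^sup>2 \<noteq> n"
  then show "(\<Sum>(u, v, w)\<in>triples n. (n - int (Suc 4) * u\<^sup>2) * ((2 * w - v) * corr v w)) = 0"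
    using corr_recurrence[of n] by (simp add: diagonal_nonsquare)
qed

section \<open>Sums of squares for odd numbers\<close>

lemma divsum_odd_eq_sigma:
  assumes "odd k"
  shows "divsum (\<lambda>v w. (2 * w - v) * corr v w) (int k) = int (sigma k)"
proof -
  let ?P = "{(v, w). 0 < v \<and> 0 < w \<and> v * w = int k}"
  have k: "k > 0" using assms by (auto intro: Nat.gr0I)
  have fst: "(\<Sum>(v, w)\<in>?P. v) = int (sigma k)"
    unfolding sigma_def of_nat_sum
  proof (rule sum.reindex_bij_witness[of _ "\<lambda>e. (int e, int (k div e))" "\<lambda>(v, w). nat v"])
    fix a assume "a \<in> ?P"
    then obtain v w where a: "a = (v, w)" "0 < v" "0 < w" "v * w = int k" by auto
    then have "k = nat v * nat w" by (metis nat_int nat_mult_distrib less_imp_le)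
    with a show "(\<lambda>e. (int e, int (k div e))) ((\<lambda>(v, w). nat v) a) = a"
      "(\<lambda>(v, w). nat v) a \<in> {e. e dvd k}" "int ((\<lambda>(v, w). nat v) a) = (case a of (v, w) \<Rightarrow> v)"
      by simp_all
  qed (use k in \<open>auto simp: zero_less_mult_iff simp flip: of_nat_mult elim!: dvdE\<close>)
  have snd: "(\<Sum>(v, w)\<in>?P. w) = (\<Sum>(v, w)\<in>?P. v)"
    by (rule sum.reindex_bij_witness[of _ "\<lambda>(v, w). (w, v)" "\<lambda>(v, w). (w, v)"])
      (auto simp: mult.commute)
  \<comment> \<open>For odd \<open>k\<close> every sign is 1. What remains is twice the sum of the
    \<open>w\<close> minus the sum of the \<open>v\<close>, and each of these two sums is
    \<open>sigma k\<close>.\<close>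
  have "divsum (\<lambda>v w. (2 * w - v) * corr v w) (int k) = (\<Sum>(v, w)\<in>?P. 2 * w - v)"
    unfolding divsum_def
  proof (rule sum.cong)
    fix a assume "a \<in> ?P"
    then obtain v w where a: "a = (v, w)" "v * w = int k" by auto
    with assms have "odd (v * w)" by simp
    then have "odd v" by simp
    then show "(case a of (v, w) \<Rightarrow> (2 * w - v) * corr v w) = (case a of (v, w) \<Rightarrow> 2 * w - v)"
      by (simp add: a corr_def)
  qed simp
  also have "\<dots> = 2 * (\<Sum>(v, w)\<in>?P. w) - (\<Sum>(v, w)\<in>?P. v)"
    by (simp only: case_prod_unfold sum_subtractf sum_distrib_left)
  finally show ?thesis using fst snd by simp
qed

text \<open>The odd entries of all representations are counted twice: one per representation, and
  equally many in each coordinate.\<close>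

lemma card_sq_reps_one_odd:
  assumes "\<And>xs. xs \<in> sq_reps s n \<Longrightarrow> (\<Sum>i<s. if odd (xs ! i) then 1 else 0) = (1::int)"
  shows "int (card (sq_reps s n)) = int s * int (card {xs \<in> sq_reps s n. odd (xs ! 0)})"
proof -
  have "int (card (sq_reps s n)) = (\<Sum>xs\<in>sq_reps s n. \<Sum>i<s. if odd (xs ! i) then 1 else 0)"
    using assms by simp
  also have "\<dots> = int s * (\<Sum>xs\<in>sq_reps s n. if odd (xs ! 0) then 1 else 0)"
    by (rule sum_sq_reps_coordinates)
  also have "(\<Sum>xs\<in>sq_reps s n. if odd (xs ! 0) then 1 else 0) = int (card {xs \<in> sq_reps s n. odd (xs ! 0)})"
    by (simp add: finite_sq_reps flip: sum.inter_filter)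
  finally show ?thesis .
qed

lemma square_mod_4: "(x::int)\<^sup>2 mod 4 = (if odd x then 1 else 0)"
proof -
  have "x\<^sup>2 mod 4 = ((x mod 4) * (x mod 4)) mod 4" by (simp add: power2_eq_square mod_mult_eq)
  moreover have "x mod 4 = 0 \<or> x mod 4 = 1 \<or> x mod 4 = 2 \<or> x mod 4 = 3" by presburger
  moreover have "odd x = odd (x mod 4)" by presburger
  ultimately show ?thesis by (elim disjE) simp_all
qed

lemma card_odd_square_plus_four_eq:
  assumes "odd m"
  shows "card {(x, b). x\<^sup>2 + 4 * b\<^sup>2 = m} = card {xs \<in> sq_reps 2 m. odd (xs ! 0)}"
proof (rule bij_betw_same_card, rule bij_betw_byWitness[where f = "\<lambda>(x, b). [x, 2 * b]"
      and f' = "\<lambda>xs. (xs ! 0, xs ! 1 div 2)"])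
  have "even (xs ! Suc 0)" if "xs \<in> sq_reps 2 m" "odd (xs ! 0)" for xs
    using that assms by (auto simp: sq_reps_def numeral_2_eq_2 length_Suc_conv)
  then show "\<forall>xs\<in>{xs \<in> sq_reps 2 m. odd (xs ! 0)}.
      (\<lambda>(x, b). [x, 2 * b]) (xs ! 0, xs ! 1 div 2) = xs"
    by (auto simp: sq_reps_def numeral_2_eq_2 length_Suc_conv)
  show "(\<lambda>xs. (xs ! 0, xs ! 1 div 2)) ` {xs \<in> sq_reps 2 m. odd (xs ! 0)} \<subseteq> {(x, b). x\<^sup>2 + 4 * b\<^sup>2 = m}"
    using assms by (auto simp: sq_reps_def numeral_2_eq_2 length_Suc_conv elim!: evenE)
qed (use assms in \<open>auto simp: sq_reps_def power_mult_distrib\<close>)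

subsection \<open>The form \<open>x\<^sup>2 + 4 (a\<^sup>2 + b\<^sup>2 + c\<^sup>2)\<close>\<close>

text \<open>The order of the components lets \<open>c\<close> and then \<open>a\<close> be fixed,
  leaving \<open>x^2 + 4 b^2\<close>.\<close>

definition mixed_reps :: "int \<Rightarrow> (int \<times> int \<times> int \<times> int) set" where
  "mixed_reps n = {(c, a, x, b). x\<^sup>2 + 4 * (a\<^sup>2 + b\<^sup>2 + c\<^sup>2) = n}"

text \<open>Squares are 0 or 1 modulo 4, so the number of odd entries is 1 modulo 4 and at most
  4.\<close>

lemma one_odd_of_four:
  assumes "(p\<^sup>2 + q\<^sup>2 + r\<^sup>2 + s\<^sup>2) mod 4 = (1::int)"
  shows "(if odd p then 1 else 0) + (if odd q then 1 else 0) + (if odd r then 1 else 0)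
    + (if odd s then 1 else 0) = (1::int)"
proof -
  have "(p\<^sup>2 mod 4 + q\<^sup>2 mod 4 + r\<^sup>2 mod 4 + s\<^sup>2 mod 4) mod 4 = 1" using assms by presburger
  then show ?thesis unfolding square_mod_4 by (simp split: if_splits)
qed

lemma card_mixed_reps_eq:
  assumes "m mod 4 = 1"
  shows "card (mixed_reps m) = card {xs \<in> sq_reps 4 m. odd (xs ! 0)}"
proof (rule bij_betw_same_card, rule bij_betw_byWitness[where f = "\<lambda>(c, a, x, b). [x, 2 * a, 2 * b, 2 * c]"
      and f' = "\<lambda>xs. (xs ! 3 div 2, xs ! 1 div 2, xs ! 0, xs ! 2 div 2)"])
  have odd_m: "odd m" using assms by presburger
  have *: "\<exists>x a b c. xs = [x, 2 * a, 2 * b, 2 * c] \<and> x\<^sup>2 + 4 * (a\<^sup>2 + b\<^sup>2 + c\<^sup>2) = m"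
    if xs: "xs \<in> sq_reps 4 m" "odd (xs ! 0)" for xs
  proof -
    obtain x p q r where e: "xs = [x, p, q, r]"
      using xs by (auto simp: sq_reps_def eval_nat_numeral length_Suc_conv)
    with xs have o: "odd x" and m: "x\<^sup>2 + p\<^sup>2 + q\<^sup>2 + r\<^sup>2 = m" by (auto simp: sq_reps_def)
    have "even p" "even q" "even r"
      using one_odd_of_four[of x p q r] m assms o by (auto split: if_splits)
    then obtain a b c where "p = 2 * a" "q = 2 * b" "r = 2 * c" by (auto elim!: evenE)
    with e m show ?thesis by auto
  qed
  show "\<forall>xs\<in>{xs \<in> sq_reps 4 m. odd (xs ! 0)}. (\<lambda>(c, a, x, b). [x, 2 * a, 2 * b, 2 * c])
      (xs ! 3 div 2, xs ! 1 div 2, xs ! 0, xs ! 2 div 2) = xs"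
    using * by fastforce
  show "(\<lambda>xs. (xs ! 3 div 2, xs ! 1 div 2, xs ! 0, xs ! 2 div 2)) `
      {xs \<in> sq_reps 4 m. odd (xs ! 0)} \<subseteq> mixed_reps m"
    using * by (fastforce simp: mixed_reps_def)
  show "(\<lambda>(c, a, x, b). [x, 2 * a, 2 * b, 2 * c]) ` mixed_reps m \<subseteq> {xs \<in> sq_reps 4 m. odd (xs ! 0)}"
    using odd_m by (auto simp: mixed_reps_def sq_reps_def power_mult_distrib)
qed auto

lemma card_mixed_reps:
  assumes "k mod 4 = 1"
  shows "card (mixed_reps (int k)) = 2 * sigma k"
proof -
  have m: "int k mod 4 = 1" using assms by presburger
  have k: "odd k" using assms by presburger
  have "int (card (sq_reps 4 (int k))) = 8 * int (sigma k)"
    using four_squares[of "int k"] divsum_odd_eq_sigma[OF k] k by (auto split: if_splits)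
  moreover have "int (card (sq_reps 4 (int k))) = int 4 * int (card (mixed_reps (int k)))"
    unfolding card_mixed_reps_eq[OF m]
  proof (rule card_sq_reps_one_odd)
    fix xs assume xs: "xs \<in> sq_reps 4 (int k)"
    then obtain x p q r where e: "xs = [x, p, q, r]"
      by (auto simp: sq_reps_def eval_nat_numeral length_Suc_conv)
    with xs m have "(x\<^sup>2 + p\<^sup>2 + q\<^sup>2 + r\<^sup>2) mod 4 = 1" by (simp add: sq_reps_def add.assoc)
    then show "(\<Sum>i<4. if odd (xs ! i) then 1 else 0) = (1::int)"
      using one_odd_of_four[of x p q r] by (simp add: e eval_nat_numeral)
  qed
  ultimately show ?thesis by simp
qed

lemma card_odd_square_plus_four:
  assumes "odd m"
  shows "int (card {(x, b). x\<^sup>2 + 4 * b\<^sup>2 = m}) = 2 * divsum (\<lambda>v w. chi v) m"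
proof -
  have "int (card (sq_reps 2 m)) = int 2 * int (card {xs \<in> sq_reps 2 m. odd (xs ! 0)})"
  proof (rule card_sq_reps_one_odd)
    fix xs assume "xs \<in> sq_reps 2 m"
    then show "(\<Sum>i<2. if odd (xs ! i) then 1 else 0) = (1::int)"
      using assms by (auto simp: sq_reps_def numeral_2_eq_2 length_Suc_conv)
  qed
  then show ?thesis
    using two_squares[of m] assms by (auto simp: card_odd_square_plus_four_eq split: if_splits)
qed

section \<open>The alternating sum over \<open>mixed_reps\<close>\<close>

lemma finite_mixed_reps: "finite (mixed_reps n)"
proof (rule finite_subset)
  show "mixed_reps n \<subseteq> {- n..n} \<times> {- n..n} \<times> {- n..n} \<times> {- n..n}"
  proof clarify
    fix c a x b assume "(c, a, x, b) \<in> mixed_reps n"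
    then have n: "x\<^sup>2 + 4 * (a\<^sup>2 + b\<^sup>2 + c\<^sup>2) = n" by (simp add: mixed_reps_def)
    have "a\<^sup>2 \<le> n" "b\<^sup>2 \<le> n" "c\<^sup>2 \<le> n" "x\<^sup>2 \<le> n" by (simp_all flip: n)
    then show "c \<in> {- n..n} \<and> (a, x, b) \<in> {- n..n} \<times> {- n..n} \<times> {- n..n}"
      using square_le_imp_mem by blast
  qed
qed simp

text \<open>If \<open>m = l^2\<close>, the only root that is 1 modulo 4 is \<open>chi l * l\<close>.
  On the diagonal \<open>u + w = l\<close>, and \<open>chi w * chi w\<close> counts the
  \<open>l\<close> odd numbers up to \<open>2 * l - 1\<close>. For other \<open>m\<close> both sides
  are empty.\<close>

lemma sum_square_roots:
  assumes "m mod 4 = 1"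
  shows "(\<Sum>r | r\<^sup>2 = m \<and> [r = 1] (mod 4). r) = (\<Sum>(u, v, w)\<in>diagonal m. chi (u + w) * (chi w * chi w))"
proof (cases "\<exists>l>0. m = l\<^sup>2")
  case True
  then obtain l where l: "l > 0" "m = l\<^sup>2" by auto
  have "odd m" using assms by presburger
  then have "odd l" using l by auto
  then have l4: "l mod 4 = 1 \<or> l mod 4 = 3" by presburger
  have "{r. r\<^sup>2 = m \<and> [r = 1] (mod 4)} = {r \<in> {l, - l}. r mod 4 = 1}"
    by (auto simp: l(2) power2_eq_iff cong_def)
  also have "\<dots> = {chi l * l}"
    using l4
  proof
    assume "l mod 4 = 1"
    moreover from this have "(- l) mod 4 \<noteq> 1" by presburger
    ultimately show ?thesis by (auto simp: chi_def)
  next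
    assume "l mod 4 = 3"
    moreover from this have "(- l) mod 4 = 1" by presburger
    ultimately show ?thesis by (auto simp: chi_def)
  qed
  finally have "(\<Sum>r | r\<^sup>2 = m \<and> [r = 1] (mod 4). r) = chi l * l" by simp
  also have "\<dots> = (\<Sum>j = 1..2 * l - 1. chi l * (chi j * chi j))"
    using sum_chi_square[OF l(1)] by (simp flip: sum_distrib_left)
  also have "\<dots> = (\<Sum>(u, v, w)\<in>diagonal m. chi (u + w) * (chi w * chi w))"
    by (simp add: l(2) sum_diagonal_square[OF l(1)])
  finally show ?thesis .
next
  case False
  have "m \<noteq> 0" using assms by auto
  with False have "r\<^sup>2 \<noteq> m" for r
    by (metis abs_le_zero_iff not_le power2_abs zero_power2)
  moreover have "diagonal m = {}" by (rule diagonal_nonsquare) (use False in auto)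
  ultimately show ?thesis by simp
qed

text \<open>The two square theorem turns each count into a divisor sum; together these form the left
  side of \<open>three_squares_identity\<close>, with \<open>u = 2 * a\<close>.\<close>

lemma sum_par_card:
  assumes "m mod 4 = 1" "m \<le> K"
  shows "(\<Sum>a = - K..K. par a * int (card {(x, b). x\<^sup>2 + 4 * b\<^sup>2 = m - 4 * a\<^sup>2})) =
    2 * (\<Sum>r | r\<^sup>2 = m \<and> [r = 1] (mod 4). r)"
proof -
  let ?g = "\<lambda>u. if even u then par (u div 2) else 0"
  have "int (card {(x, b). x\<^sup>2 + 4 * b\<^sup>2 = m - 4 * a\<^sup>2}) = 2 * divsum (\<lambda>v w. chi v) (m - 4 * a\<^sup>2)" for a
    by (rule card_odd_square_plus_four) (use assms(1) in presburger)
  then have "(\<Sum>a = - K..K. par a * int (card {(x, b). x\<^sup>2 + 4 * b\<^sup>2 = m - 4 * a\<^sup>2})) =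
      2 * (\<Sum>a = - K..K. par a * divsum (\<lambda>v w. chi v) (m - 4 * a\<^sup>2))"
    by (simp add: sum_distrib_left ac_simps)
  also have "(\<Sum>a = - K..K. par a * divsum (\<lambda>v w. chi v) (m - 4 * a\<^sup>2)) =
      (\<Sum>u \<in> {u \<in> {- (2 * K)..2 * K}. even u}. par (u div 2) * divsum (\<lambda>v w. chi v) (m - u\<^sup>2))"
    by (rule sum.reindex_bij_witness[of _ "\<lambda>u. u div 2" "\<lambda>a. 2 * a"])
      (auto simp: power_mult_distrib elim!: evenE)
  also have "\<dots> = (\<Sum>u = - (2 * K)..2 * K. ?g u * divsum (\<lambda>v w. chi v) (m - u\<^sup>2))"
    by (subst sum.inter_filter) (auto intro!: sum.cong)
  also have "\<dots> = (\<Sum>(u, v, w)\<in>triples m. ?g u * chi v)"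
  \<comment> \<open>Negative \<open>m\<close> does occur, as \<open>m\<close> will be
    \<open>N - 4 c^2\<close>. Then \<open>m <= 2 * K\<close> may fail, but both sides are 0.\<close>
  proof (cases "m \<ge> 0")
    case True
    then show ?thesis using assms(2) by (subst sum_triples[of m "2 * K"]) auto
  next
    case False
    have "m - u\<^sup>2 \<le> 0" for u using False zero_le_power2[of u] by linarith
    moreover have "triples m = {}" using triples_subset[of m] False by auto
    ultimately show ?thesis by (simp add: divsum_nonpos)
  qed
  also have "\<dots> = (\<Sum>(u, v, w)\<in>triples m. if even u then chi v * par (u div 2) else 0)"
    by (rule sum.cong) auto
  also have "\<dots> = (\<Sum>r | r\<^sup>2 = m \<and> [r = 1] (mod 4). r)"
    using three_squares_identity[OF assms(1)] sum_square_roots[OF assms(1)] by simp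
  finally show ?thesis .
qed

text \<open>For fixed \<open>c\<close>, \<open>sum_par_card\<close> applies to
  \<open>m = k - 4 c^2\<close>, which is still 1 modulo 4. The roots \<open>r\<close> of these
  \<open>m\<close>, taken over all \<open>c\<close>, form the pairs \<open>(r, c)\<close> in
  \<open>S_reps 4 k\<close>.\<close>

lemma sum_par_mixed_reps:
  assumes "k mod 4 = 1"
  shows "(\<Sum>(c, a, x, b)\<in>mixed_reps (int k). par a) = 2 * S 4 k"
proof -
  let ?N = "int k"
  have bound: "c \<in> {- ?N..?N}" "a \<in> {- ?N..?N}" if "(c, a, x, b) \<in> mixed_reps ?N" for c a x b
  proof -
    from that have n: "x\<^sup>2 + 4 * (a\<^sup>2 + b\<^sup>2 + c\<^sup>2) = ?N" by (simp add: mixed_reps_def)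
    have "a\<^sup>2 \<le> ?N" "c\<^sup>2 \<le> ?N" by (simp_all flip: n)
    then show "c \<in> {- ?N..?N}" "a \<in> {- ?N..?N}" using square_le_imp_mem by blast+
  qed
  have fin: "finite {y. (c, y) \<in> mixed_reps ?N}" for c
    by (rule finite_subset[OF _ finite_imageI[OF finite_mixed_reps[of ?N], of snd]]) force
  have "(\<Sum>(c, a, x, b)\<in>mixed_reps ?N. par a) = (\<Sum>(c, y)\<in>mixed_reps ?N. par (fst y))"
    by (rule sum.cong) auto
  also have "\<dots> = (\<Sum>c = - ?N..?N. \<Sum>y | (c, y) \<in> mixed_reps ?N. par (fst y))"
    by (rule sum_fibres) (use finite_mixed_reps bound in auto)
  also have "\<dots> = (\<Sum>c = - ?N..?N. 2 * (\<Sum>r | r\<^sup>2 = ?N - 4 * c\<^sup>2 \<and> [r = 1] (mod 4). r))"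
  proof (rule sum.cong)
    fix c
    have "(\<Sum>y | (c, y) \<in> mixed_reps ?N. par (fst y)) = (\<Sum>(a, y)\<in>{y. (c, y) \<in> mixed_reps ?N}. par a)"
      by (rule sum.cong) auto
    also have "\<dots> = (\<Sum>a = - ?N..?N. \<Sum>y | (a, y) \<in> {y. (c, y) \<in> mixed_reps ?N}. par a)"
      by (rule sum_fibres) (use fin bound in auto)
    also have "\<dots> = (\<Sum>a = - ?N..?N. par a *
        int (card {(x, b). x\<^sup>2 + 4 * b\<^sup>2 = (?N - 4 * c\<^sup>2) - 4 * a\<^sup>2}))"
    proof (rule sum.cong)
      fix a
      have "{y. (a, y) \<in> {y. (c, y) \<in> mixed_reps ?N}} =
          {(x, b). x\<^sup>2 + 4 * b\<^sup>2 = (?N - 4 * c\<^sup>2) - 4 * a\<^sup>2}"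
        by (auto simp: mixed_reps_def)
      then show "(\<Sum>y | (a, y) \<in> {y. (c, y) \<in> mixed_reps ?N}. par a) = par a *
        int (card {(x, b). x\<^sup>2 + 4 * b\<^sup>2 = (?N - 4 * c\<^sup>2) - 4 * a\<^sup>2})"
        by simp
    qed simp
    also have "\<dots> = 2 * (\<Sum>r | r\<^sup>2 = ?N - 4 * c\<^sup>2 \<and> [r = 1] (mod 4). r)"
    proof (rule sum_par_card)
      show "(?N - 4 * c\<^sup>2) mod 4 = 1" using assms by presburger
    qed simp
    finally show "(\<Sum>y | (c, y) \<in> mixed_reps ?N. par (fst y)) =
      2 * (\<Sum>r | r\<^sup>2 = ?N - 4 * c\<^sup>2 \<and> [r = 1] (mod 4). r)" .
  qed simp
  also have "\<dots> = 2 * (\<Sum>c = - ?N..?N. \<Sum>r | r\<^sup>2 = ?N - 4 * c\<^sup>2 \<and> [r = 1] (mod 4). r)"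
    by (simp add: sum_distrib_left)
  also have "(\<Sum>c = - ?N..?N. \<Sum>r | r\<^sup>2 = ?N - 4 * c\<^sup>2 \<and> [r = 1] (mod 4). r) =
      (\<Sum>c = - ?N..?N. \<Sum>r | (c, r) \<in> prod.swap ` S_reps 4 k. r)"
    by (intro sum.cong) (auto simp: S_reps_def image_iff)
  also have "\<dots> = (\<Sum>(c, r)\<in>prod.swap ` S_reps 4 k. r)"
  proof (rule sum_fibres[symmetric])
    fix c r assume "(c, r) \<in> prod.swap ` S_reps 4 k"
    then have eq: "r\<^sup>2 + 4 * c\<^sup>2 = ?N" by (auto simp: S_reps_def)
    have "c\<^sup>2 \<le> ?N" by (simp flip: eq)
    then show "c \<in> {- ?N..?N}" by (rule square_le_imp_mem)
  qed (simp_all add: finite_S_reps)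
  also have "\<dots> = S 4 k"
    unfolding S_def by (subst sum.reindex) (auto simp: case_prod_unfold)
  finally show ?thesis .
qed

section \<open>Triangular numbers and the final count\<close>

lemma t_eq_card: "t 1 2 2 4 n = card {(c, a, x, b) \<in> mixed_reps (int (8 * n + 9)). odd a}"
proof -
  let ?N = "int (8 * n + 9)"
  \<comment> \<open>Completing squares gives weights 1, 2, 2, 4 on odd squares and the constant
    \<open>9 = 1 + 2 + 2 + 4\<close>. The two middle terms combine by
    \<open>2 (p^2 + q^2) = (p + q)^2 + (p - q)^2\<close> with \<open>p = 2 * y - 1\<close> and
    \<open>q = 2 * z - 1\<close>.\<close>
  let ?f = "\<lambda>(x, y, z, w). (y - z, 2 * w - 1, 2 * x - 1, y + z - 1)"
  let ?f' = "\<lambda>(c, a, x, b). ((x + 1) div 2, (b + c + 1) div 2, (b - c + 1) div 2, (a + 1) div 2)"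
  have mem: "(x, y, z, w) \<in> tri_reps 1 2 2 4 n \<longleftrightarrow> ?f (x, y, z, w) \<in> mixed_reps ?N" for x y z w
  proof -
    define p q r s where pqrs: "p = x * (x - 1) div 2" "q = y * (y - 1) div 2"
      "r = z * (z - 1) div 2" "s = w * (w - 1) div 2"
    then have e: "x * (x - 1) = 2 * p" "y * (y - 1) = 2 * q" "z * (z - 1) = 2 * r"
      "w * (w - 1) = 2 * s" by simp_all
    have "(2 * x - 1)\<^sup>2 + 4 * ((2 * w - 1)\<^sup>2 + (y + z - 1)\<^sup>2 + (y - z)\<^sup>2) =
        4 * (x * (x - 1)) + 8 * (y * (y - 1)) + 8 * (z * (z - 1)) + 16 * (w * (w - 1)) + 9"
      by (simp add: power2_eq_square algebra_simps)
    also have "\<dots> = 8 * (p + 2 * q + 2 * r + 4 * s) + 9"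
      unfolding e by simp
    finally show ?thesis
      unfolding tri_reps_def mixed_reps_def by (auto simp: e simp flip: pqrs)
  qed
  have inv: "?f (?f' (c, a, x, b)) = (c, a, x, b)" if "(c, a, x, b) \<in> mixed_reps ?N" "odd a" for c a x b
  proof -
    from that have N: "x\<^sup>2 + 4 * (a\<^sup>2 + b\<^sup>2 + c\<^sup>2) = 8 * int n + 9" by (simp add: mixed_reps_def)
    then have "odd (x\<^sup>2 + 4 * (a\<^sup>2 + b\<^sup>2 + c\<^sup>2))" by simp
    then have x: "odd x" by simp
    \<comment> \<open>Both \<open>x^2\<close> and \<open>8 * n + 9\<close> are 1 modulo 8, so
      \<open>a^2 + b^2 + c^2\<close> is even. With \<open>a\<close> odd, exactly one of
      \<open>b\<close> and \<open>c\<close> is odd, and all halvings in \<open>?f'\<close> are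
      exact.\<close>
    then obtain p where p: "x = 2 * p + 1" by (auto elim: oddE)
    have "even (p * (p + 1))" by simp
    then obtain q where "p * (p + 1) = 2 * q" by (rule evenE)
    then have "x\<^sup>2 = 8 * q + 1" by (simp add: p power2_eq_square algebra_simps)
    with N have "a\<^sup>2 + b\<^sup>2 + c\<^sup>2 = 2 * (int n + 1 - q)" by simp
    then have "even (a\<^sup>2 + b\<^sup>2 + c\<^sup>2)" by simp
    then have "odd (b + c)" "odd (b - c)" using that(2) by auto
    then show ?thesis using x that(2) by (auto elim!: oddE)
  qed
  have "bij_betw ?f (tri_reps 1 2 2 4 n) {(c, a, x, b) \<in> mixed_reps ?N. odd a}"
  proof (rule bij_betw_byWitness[where f' = ?f'])
    show "?f' ` {(c, a, x, b) \<in> mixed_reps ?N. odd a} \<subseteq> tri_reps 1 2 2 4 n"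
      using inv mem by fastforce
  qed (use inv mem in auto)
  then show ?thesis unfolding t_def by (rule bij_betw_same_card)
qed

theorem theorem3p3:
  fixes n :: nat
  assumes "n > 0"
  shows "int (t 1 2 2 4 n) = int (sigma (8 * n + 9)) - S 4 (8 * n + 9)"
proof -
  let ?k = "8 * n + 9" and ?odd = "{(c, a, x, b) \<in> mixed_reps (int (8 * n + 9)). odd a}"
  have k: "?k mod 4 = 1" by presburger
  have "2 * S 4 ?k = (\<Sum>(c, a, x, b)\<in>mixed_reps (int ?k). par a)"
    by (rule sum_par_mixed_reps[OF k, symmetric])
  \<comment> \<open>The sign is 1 minus twice the indicator of odd \<open>a\<close>, so the
    alternating sum is the full count \<open>2 * sigma ?k\<close> minus twice the number counted by
    \<open>t\<close>.\<close>
  also have "\<dots> = (\<Sum>z\<in>mixed_reps (int ?k). 1 - 2 * (if odd (fst (snd z)) then 1 else 0))"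
    by (rule sum.cong) (auto simp: par_def)
  also have "\<dots> = int (card (mixed_reps (int ?k))) - 2 * (\<Sum>z\<in>mixed_reps (int ?k). if odd (fst (snd z)) then 1 else 0)"
    by (simp add: sum_subtractf flip: sum_distrib_left)
  also have "(\<Sum>z\<in>mixed_reps (int ?k). if odd (fst (snd z)) then 1 else 0) = int (card ?odd)"
    by (simp add: finite_mixed_reps case_prod_unfold flip: sum.inter_filter)
  finally show ?thesis using card_mixed_reps[OF k] t_eq_card[of n] by simp
qed

end
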